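(* Let $G$ be a group acting on a set $X$. Let $x,y,x',y'\in X$ with $G_x\le G_y$, $Gx\neq Gy$, $G_{x'}\le G_{y'}$, $Gx'\neq Gy'$, so that $[x\mapsto y]$ and $[x'\mapsto y']$ are fixing elementary collapsings. Then $[x\mapsto y]\sim_{\mathcal{R}}[x'\mapsto y']$ if and only if there exists $g\in G$ such that $x'=g\cdot x$.
   Context: $\mathrm{End}_G(X)$ is the monoid, under composition $(fg)(x)=f(g(x))$, of all $G$-equivariant functions $X\to X$. Write $S=\mathrm{End}_G(X)$. For $a,b\in S$, $a\sim_{\mathcal{R}} b$ means $aS=bS$, where $aS=\{as : s\in S\}$. $G_x$ is the stabilizer and $Gx$ the orbit of $x$. For $x,y\in X$ with $G_x\le G_y$ and $Gx\neq Gy$, $[x\mapsto y]\in\mathrm{End}_G(X)$ is the function with $[x\mapsto y](g\cdot x)=g\cdot y$ for $g\in G$ and $[x\mapsto y](z)=z$ for $z\notin Gx$; the functions of this form are exactly the fixing elementary collapsings. *)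

theory Defs
  imports "HOL-Algebra.Group_Action"
begin

text \<open>
  Self-maps of \<open>X\<close> are represented as in \<^const>\<open>BijGroup\<close>: they are extensional, so that
  equality of functions is equality on \<open>X\<close>, and they are composed with \<^const>\<open>compose\<close>.
\<close>

definition EndG :: "('g, 'm) monoid_scheme \<Rightarrow> 'x set \<Rightarrow> ('g \<Rightarrow> 'x \<Rightarrow> 'x) \<Rightarrow> ('x \<Rightarrow> 'x) monoid"
  where "EndG G X \<phi> =
    \<lparr>carrier = {f \<in> X \<rightarrow>\<^sub>E X. \<forall>g\<in>carrier G. \<forall>x\<in>X. f (\<phi> g x) = \<phi> g (f x)},
     mult = compose X,
     one = \<lambda>x\<in>X. x\<rparr>"

definition R_rel :: "('s, 'm) monoid_scheme \<Rightarrow> 's \<Rightarrow> 's \<Rightarrow> bool"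
  where "R_rel S a b \<longleftrightarrow> a <#\<^bsub>S\<^esub> carrier S = b <#\<^bsub>S\<^esub> carrier S"

text \<open>
  The map \<open>[x \<mapsto> y]\<close>. The value does not depend on the choice of \<open>g\<close> when the stabilizer of \<open>x\<close>
  is contained in that of \<open>y\<close>; see \<open>collapsing_orbit\<close> below.
\<close>

definition collapsing ::
    "('g, 'm) monoid_scheme \<Rightarrow> 'x set \<Rightarrow> ('g \<Rightarrow> 'x \<Rightarrow> 'x) \<Rightarrow> 'x \<Rightarrow> 'x \<Rightarrow> 'x \<Rightarrow> 'x"
  where "collapsing G X \<phi> x y =
    (\<lambda>z\<in>X. if z \<in> orbit G \<phi> x then \<phi> (SOME g. g \<in> carrier G \<and> \<phi> g x = z) y else z)"

context group_action
begin

lemma monoid_EndG: "monoid (EndG G E \<phi>)"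
proof (rule monoidI)
  fix f h assume "f \<in> carrier (EndG G E \<phi>)" "h \<in> carrier (EndG G E \<phi>)"
  then show "f \<otimes>\<^bsub>EndG G E \<phi>\<^esub> h \<in> carrier (EndG G E \<phi>)"
    using element_image by (auto simp: EndG_def compose_def PiE_iff)
next
  show "\<one>\<^bsub>EndG G E \<phi>\<^esub> \<in> carrier (EndG G E \<phi>)"
    using element_image by (auto simp: EndG_def)
next
  fix f h k
  assume "f \<in> carrier (EndG G E \<phi>)" "h \<in> carrier (EndG G E \<phi>)" "k \<in> carrier (EndG G E \<phi>)"
  then show "f \<otimes>\<^bsub>EndG G E \<phi>\<^esub> h \<otimes>\<^bsub>EndG G E \<phi>\<^esub> k = f \<otimes>\<^bsub>EndG G E \<phi>\<^esub> (h \<otimes>\<^bsub>EndG G E \<phi>\<^esub> k)"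
    by (auto simp: EndG_def compose_def fun_eq_iff)
next
  fix f assume "f \<in> carrier (EndG G E \<phi>)"
  then show "\<one>\<^bsub>EndG G E \<phi>\<^esub> \<otimes>\<^bsub>EndG G E \<phi>\<^esub> f = f" "f \<otimes>\<^bsub>EndG G E \<phi>\<^esub> \<one>\<^bsub>EndG G E \<phi>\<^esub> = f"
    by (auto simp: EndG_def PiE_def)
qed

lemma collapsing_orbit:
  assumes "x \<in> E" "y \<in> E" "stabilizer G \<phi> x \<subseteq> stabilizer G \<phi> y" "g \<in> carrier G"
  shows "collapsing G E \<phi> x y (\<phi> g x) = \<phi> g y"
proof -
  interpret group G using group_hom group_hom.axioms(1) by auto
  define h where "h = (SOME h. h \<in> carrier G \<and> \<phi> h x = \<phi> g x)"
  have h: "h \<in> carrier G" "\<phi> h x = \<phi> g x"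
    using someI[of "\<lambda>h. h \<in> carrier G \<and> \<phi> h x = \<phi> g x" g] assms(4) unfolding h_def by auto
  have "\<phi> (inv g \<otimes> h) x = x"
    using composition_rule[of x "inv g" h] orbit_sym_aux[of g x] assms h by simp
  then have "inv g \<otimes> h \<in> stabilizer G \<phi> x"
    using assms h by (simp add: stabilizer_def)
  then have "inv g \<otimes> h \<in> stabilizer G \<phi> y" using assms by blast
  then have "\<phi> g y = \<phi> g (\<phi> (inv g \<otimes> h) y)" by (simp add: stabilizer_def)
  also have "\<dots> = \<phi> (g \<otimes> (inv g \<otimes> h)) y"
    using composition_rule[of y g "inv g \<otimes> h"] assms h by simp
  also have "\<dots> = \<phi> h y" using assms h by (simp add: m_assoc[symmetric])
  finally have "\<phi> g y = \<phi> h y" .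
  then show ?thesis
    using assms element_image by (auto simp: collapsing_def orbit_def h_def)
qed

lemma collapsing_fixed:
  assumes "z \<in> E" "z \<notin> orbit G \<phi> x"
  shows "collapsing G E \<phi> x y z = z"
  using assms by (simp add: collapsing_def)

lemma collapsing_in_EndG:
  assumes xy: "x \<in> E" "y \<in> E" "stabilizer G \<phi> x \<subseteq> stabilizer G \<phi> y"
  shows "collapsing G E \<phi> x y \<in> carrier (EndG G E \<phi>)"
proof -
  interpret group G using group_hom group_hom.axioms(1) by auto
  let ?c = "collapsing G E \<phi> x y"
  have *: "?c z \<in> E \<and> (\<forall>g\<in>carrier G. ?c (\<phi> g z) = \<phi> g (?c z))" if z: "z \<in> E" for z
  proof (cases "z \<in> orbit G \<phi> x")
    case True
    then obtain h where h: "h \<in> carrier G" "z = \<phi> h x" by (auto simp: orbit_def)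
    have "?c (\<phi> g z) = \<phi> g (?c z)" if "g \<in> carrier G" for g
      using h that xy collapsing_orbit[OF xy, of "g \<otimes> h"] collapsing_orbit[OF xy, of h]
      by (simp add: composition_rule)
    then show ?thesis using h xy collapsing_orbit[OF xy, of h] element_image by auto
  next
    case False
    have "\<phi> g z \<notin> orbit G \<phi> x" if g: "g \<in> carrier G" for g
    proof
      assume "\<phi> g z \<in> orbit G \<phi> x"
      then obtain h where h: "h \<in> carrier G" "\<phi> g z = \<phi> h x" by (auto simp: orbit_def)
      then have "z = \<phi> (inv g \<otimes> h) x"
        using orbit_sym_aux[of g z] composition_rule[of x "inv g" h] g z xy by simp
      with h g False show False by (auto simp: orbit_def)
    qed
    then show ?thesis using False z element_image by (auto simp: collapsing_fixed)
  qed
  then show ?thesis by (auto simp: EndG_def PiE_iff collapsing_def)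
qed

end

end

theory Submission
  imports Defs
begin

text \<open>
  The map \<open>[x \<mapsto> y]\<close> is idempotent with image \<open>X \<setminus> Gx\<close>. Elements generating the same right ideal
  have the same image, and two idempotents with the same image absorb each other from the left.
\<close>

context group_action
begin

lemma orbit_eqI:
  assumes "x \<in> E" "y \<in> E" "y \<in> orbit G \<phi> x"
  shows "orbit G \<phi> y = orbit G \<phi> x"
proof -
  have x: "x \<in> orbit G \<phi> y" using orbit_sym assms by blast
  \<comment> \<open>\<open>orbit\<close> is defined as a bare set of values
    \<open>\<phi> g w\<close>, while \<open>orbit_trans\<close> asks for all three points in
    \<open>E\<close>.\<close>
  have E: "z \<in> E" if "z \<in> orbit G \<phi> w" "w \<in> E" for z w
    using that element_image by (auto simp: orbit_def)
  show ?thesis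
    using orbit_trans[OF assms(1,2) _ assms(3)] orbit_trans[OF assms(2,1) _ x] E assms by blast
qed

lemma EndG_mult_apply:
  "z \<in> E \<Longrightarrow> (f \<otimes>\<^bsub>EndG G E \<phi>\<^esub> h) z = f (h z)"
  by (simp add: EndG_def compose_def)

lemma EndG_closed:
  "f \<in> carrier (EndG G E \<phi>) \<Longrightarrow> z \<in> E \<Longrightarrow> f z \<in> E"
  by (auto simp: EndG_def)

text \<open>Carrier elements are extensional, so off \<open>E\<close> they agree
  automatically.\<close>

lemma EndG_eqI:
  assumes "f \<in> carrier (EndG G E \<phi>)" "h \<in> carrier (EndG G E \<phi>)"
    and "\<And>z. z \<in> E \<Longrightarrow> f z = h z"
  shows "f = h"
  using assms by (auto simp: EndG_def intro: PiE_ext)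

text \<open>Since \<open>a\<close> is its own product with the identity, it lies in its own right
  ideal, hence factors as \<open>b\<close> after some \<open>s\<close>; its values are then values
  of \<open>b\<close>.\<close>

lemma image_subset_of_l_coset_subset:
  assumes a: "a \<in> carrier (EndG G E \<phi>)"
    and sub: "a <#\<^bsub>EndG G E \<phi>\<^esub> carrier (EndG G E \<phi>) \<subseteq> b <#\<^bsub>EndG G E \<phi>\<^esub> carrier (EndG G E \<phi>)"
  shows "a ` E \<subseteq> b ` E"
proof -
  interpret S: monoid "EndG G E \<phi>" by (rule monoid_EndG)
  have "a \<in> a <#\<^bsub>EndG G E \<phi>\<^esub> carrier (EndG G E \<phi>)"
    unfolding l_coset_def using S.r_one[OF a] by (intro UN_I[OF S.one_closed]) simp
  then obtain s where s: "s \<in> carrier (EndG G E \<phi>)" "a = b \<otimes>\<^bsub>EndG G E \<phi>\<^esub> s"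
    using sub unfolding l_coset_def by blast
  have "a z \<in> b ` E" if "z \<in> E" for z
    using EndG_closed[OF s(1) that] that by (simp add: s(2) EndG_mult_apply)
  then show ?thesis by blast
qed

text \<open>The last hypothesis says that \<open>b\<close> fixes the image of \<open>a\<close>
  pointwise. Thus \<open>ba = a\<close>, and by associativity \<open>as = b(as)\<close> for every
  \<open>s\<close>.\<close>

lemma l_coset_subset_of_absorb:
  assumes "a \<in> carrier (EndG G E \<phi>)" "b \<in> carrier (EndG G E \<phi>)"
    and "\<And>z. z \<in> E \<Longrightarrow> b (a z) = a z"
  shows "a <#\<^bsub>EndG G E \<phi>\<^esub> carrier (EndG G E \<phi>) \<subseteq> b <#\<^bsub>EndG G E \<phi>\<^esub> carrier (EndG G E \<phi>)"
proof -
  interpret S: monoid "EndG G E \<phi>" by (rule monoid_EndG)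
  have "b \<otimes>\<^bsub>EndG G E \<phi>\<^esub> a = a"
    using assms by (intro EndG_eqI) (auto simp: EndG_mult_apply)
  then have "a \<otimes>\<^bsub>EndG G E \<phi>\<^esub> s = b \<otimes>\<^bsub>EndG G E \<phi>\<^esub> (a \<otimes>\<^bsub>EndG G E \<phi>\<^esub> s)"
    if "s \<in> carrier (EndG G E \<phi>)" for s
    using S.m_assoc[of b a s] that assms by simp
  then show ?thesis
    using assms(1) unfolding l_coset_def by blast
qed

text \<open>The orbit of \<open>x\<close> is carried into the orbit of \<open>y\<close>, which is
  disjoint from it, and every other point is fixed and so is its own preimage.\<close>

lemma collapsing_image:
  assumes xy: "x \<in> E" "y \<in> E" "stabilizer G \<phi> x \<subseteq> stabilizer G \<phi> y"
    and ne: "orbit G \<phi> x \<noteq> orbit G \<phi> y"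
  shows "collapsing G E \<phi> x y ` E = E - orbit G \<phi> x"
proof
  have out: "\<phi> g y \<in> E - orbit G \<phi> x" if g: "g \<in> carrier G" for g
  proof -
    have E: "\<phi> g y \<in> E" using element_image g xy by blast
    have "\<phi> g y \<in> orbit G \<phi> y" using g by (auto simp: orbit_def)
    then have "orbit G \<phi> (\<phi> g y) = orbit G \<phi> y" using orbit_eqI xy E by blast
    \<comment> \<open>If \<open>\<phi> g y\<close> also lay in the orbit of \<open>x\<close>, its
      orbit would equal both orbits, against \<open>ne\<close>.\<close>
    then show ?thesis using orbit_eqI[OF xy(1) E] E ne by auto
  qed
  show "collapsing G E \<phi> x y ` E \<subseteq> E - orbit G \<phi> x"
  proof
    fix w assume "w \<in> collapsing G E \<phi> x y ` E"
    then obtain z where z: "z \<in> E" "w = collapsing G E \<phi> x y z" by blast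
    show "w \<in> E - orbit G \<phi> x"
    proof (cases "z \<in> orbit G \<phi> x")
      case True
      then obtain g where "g \<in> carrier G" "z = \<phi> g x" by (auto simp: orbit_def)
      then show ?thesis using z collapsing_orbit[OF xy] out by simp
    next
      case False
      then show ?thesis using z by (simp add: collapsing_fixed)
    qed
  qed
  show "E - orbit G \<phi> x \<subseteq> collapsing G E \<phi> x y ` E"
    using collapsing_fixed[of _ x y] by force
qed

text \<open>The class is determined by the image, and by \<open>collapsing_image\<close> this is the
  complement of the orbit that gets collapsed.\<close>

lemma R_rel_collapsing_iff:
  assumes xy: "x \<in> E" "y \<in> E" "stabilizer G \<phi> x \<subseteq> stabilizer G \<phi> y"
      "orbit G \<phi> x \<noteq> orbit G \<phi> y"
    and xy': "x' \<in> E" "y' \<in> E" "stabilizer G \<phi> x' \<subseteq> stabilizer G \<phi> y'"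
      "orbit G \<phi> x' \<noteq> orbit G \<phi> y'"
  shows "R_rel (EndG G E \<phi>) (collapsing G E \<phi> x y) (collapsing G E \<phi> x' y')
    \<longleftrightarrow> x' \<in> orbit G \<phi> x"
proof
  note C = collapsing_in_EndG[OF xy(1-3)] and C' = collapsing_in_EndG[OF xy'(1-3)]
  note im = collapsing_image[OF xy] and im' = collapsing_image[OF xy']
  {
    assume "R_rel (EndG G E \<phi>) (collapsing G E \<phi> x y) (collapsing G E \<phi> x' y')"
    then have "E - orbit G \<phi> x \<subseteq> E - orbit G \<phi> x'"
      using image_subset_of_l_coset_subset[OF C, of "collapsing G E \<phi> x' y'"]
      unfolding R_rel_def im im' by blast
    \<comment> \<open>The point \<open>x'\<close> is missed by the second image, hence by the first,
      which misses only the orbit of \<open>x\<close>.\<close>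
    moreover have "x' \<in> orbit G \<phi> x'" using orbit_refl xy' by blast
    ultimately show "x' \<in> orbit G \<phi> x" using xy' by blast
  next
    assume "x' \<in> orbit G \<phi> x"
    then have o: "orbit G \<phi> x' = orbit G \<phi> x" using orbit_eqI xy xy' by blast
    \<comment> \<open>By \<open>o\<close> both images avoid the same orbit, and each map is the
      identity off that orbit; so each fixes the values of the other, which gives both inclusions of
      ideals.\<close>
    show "R_rel (EndG G E \<phi>) (collapsing G E \<phi> x y) (collapsing G E \<phi> x' y')"
      unfolding R_rel_def
      by (intro equalityI l_coset_subset_of_absorb C C' collapsing_fixed) (use im im' o in blast)+
  }
qed

end

theorem proposition26:
  fixes G :: "('g, 'm) monoid_scheme" and X :: "'x set" and \<phi> :: "'g \<Rightarrow> 'x \<Rightarrow> 'x"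
    and x y x' y' :: 'x
  assumes "group_action G X \<phi>"
    and "x \<in> X" and "y \<in> X" and "x' \<in> X" and "y' \<in> X"
    and "stabilizer G \<phi> x \<subseteq> stabilizer G \<phi> y" and "orbit G \<phi> x \<noteq> orbit G \<phi> y"
    and "stabilizer G \<phi> x' \<subseteq> stabilizer G \<phi> y'" and "orbit G \<phi> x' \<noteq> orbit G \<phi> y'"
  shows "R_rel (EndG G X \<phi>) (collapsing G X \<phi> x y) (collapsing G X \<phi> x' y')
    \<longleftrightarrow> (\<exists>g\<in>carrier G. x' = \<phi> g x)"
  using group_action.R_rel_collapsing_iff[OF assms(1-3,6,7,4,5,8,9)]
  by (auto simp: orbit_def)

end
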